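(* Let $G=(V,E)$ be a graph with $|V|=n$ and let $J$ be a set of subsets of $V$. Then $z^{\mathcal{E}}_{J}(G)\leqslant z^{\mathcal{C}}_{J}(G)$.
   Context: Graphs are finite, simple and undirected, with vertex set $V=\{1,\dots,n\}$, $n\geqslant 1$. $\mathcal{S}_n$ denotes the set of real symmetric $n\times n$ matrices, $\mathbf{1}_n$ the all-ones vector of length $n$, $\mathbf{1}_{n\times n}$ the all-ones matrix, $\langle X,Y\rangle=\sum_{i,j}X_{i,j}Y_{i,j}$, and $X\succcurlyeq 0$ means positive semidefinite. $\operatorname{diag}(X)$ is the vector of main-diagonal entries of $X$. For a graph $H$, the set of stable set vectors is $\mathcal{S}(H)=\{s\in\{0,1\}^{V(H)} : s_is_j=0 \text{ for all } \{i,j\}\in E(H)\}$, and the squared stable set polytope is $\operatorname{STAB}^2(H)=\operatorname{conv}\{ss^T : s\in\mathcal{S}(H)\}$. For $I\subseteq V$, $G_I$ is the subgraph of $G$ induced by $I$, and for an $n\times n$ matrix $X$, $X_I=(X_{i,j})_{i,j\in I}$. The constraint $X_I\in\operatorname{STAB}^2(G_I)$ is called the exact subgraph constraint for $G_I$ (for $I=\emptyset$ it is vacuous). Define $$\operatorname{TH}^2(G)=\{(x,X)\in\mathbb{R}^n\times\mathcal{S}_n : \operatorname{diag}(X)=x,\ X_{i,j}=0\ \forall\{i,j\}\in E,\ X-xx^T\succcurlyeq 0\},$$ $$\operatorname{CTH}^2(G)=\{X\in\mathcal{S}_n : \operatorname{trace}(X)=1,\ X_{i,j}=0\ \forall\{i,j\}\in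 E,\ X\succcurlyeq 0\}.$$ For a set $J$ of subsets of $V$ define $$z^{\mathcal{E}}_{J}(G)=\max\{\mathbf{1}_n^Tx : (x,X)\in\operatorname{TH}^2(G),\ X_I\in\operatorname{STAB}^2(G_I)\ \forall I\in J\},$$ $$z^{\mathcal{C}}_{J}(G)=\max\{\langle\mathbf{1}_{n\times n},X\rangle : X\in\operatorname{CTH}^2(G),\ X_I\in\operatorname{STAB}^2(G_I)\ \forall I\in J\}.$$ *)

theory Defs
  imports "HOL-Analysis.Analysis"
begin

text \<open>
  Graphs are finite, simple and undirected; an edge is a two-element set of vertices.
  The ambient vertex set \<open>{1,...,n}\<close> is rendered by a finite index type \<open>'n\<close>
  with \<open>n = CARD('n)\<close>, so \<open>n \<ge> 1\<close> holds automatically.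
\<close>

record 'a ugraph =
  verts :: "'a set"
  edges :: "'a set set"

definition simple_graph :: "'a ugraph \<Rightarrow> bool" where
  "simple_graph G \<longleftrightarrow>
     finite (verts G) \<and> (\<forall>e\<in>edges G. e \<subseteq> verts G \<and> card e = 2)"

definition induced_subgraph :: "'a ugraph \<Rightarrow> 'a set \<Rightarrow> 'a ugraph" where
  "induced_subgraph G I = \<lparr> verts = I, edges = {e \<in> edges G. e \<subseteq> I} \<rparr>"

definition symmetric :: "real^'n^'n \<Rightarrow> bool" where
  "symmetric X \<longleftrightarrow> transpose X = X"

definition psd :: "real^'n^'n \<Rightarrow> bool" where
  "psd X \<longleftrightarrow> symmetric X \<and> (\<forall>v. 0 \<le> v \<bullet> (X *v v))"

definition outer :: "real^'n \<Rightarrow> real^'n^'n" where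
  "outer x = (\<chi> i j. x $ i * x $ j)"

definition diag :: "real^'n^'n \<Rightarrow> real^'n" where
  "diag X = (\<chi> i. X $ i $ i)"

text \<open>
  Vectors and matrices indexed by a subset \<open>I\<close> of \<open>'n\<close> are identified with the vectors
  and matrices over \<open>'n\<close> whose entries outside \<open>I\<close>, respectively \<open>I \<times> I\<close>, are zero.
  This identification is a linear isomorphism onto a coordinate subspace, so it commutes
  with taking convex hulls and with \<open>s \<mapsto> s s\<^sup>T\<close>.
\<close>

definition submatrix :: "real^'n^'n \<Rightarrow> 'n set \<Rightarrow> real^'n^'n" where
  "submatrix X I = (\<chi> i j. if i \<in> I \<and> j \<in> I then X $ i $ j else 0)"

definition stable_set_vectors :: "'n ugraph \<Rightarrow> (real^'n) set" where
  "stable_set_vectors H =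
     {s. (\<forall>i\<in>verts H. s $ i \<in> {0, 1}) \<and> (\<forall>i. i \<notin> verts H \<longrightarrow> s $ i = 0) \<and>
         (\<forall>i j. {i, j} \<in> edges H \<longrightarrow> s $ i * s $ j = 0)}"

definition STAB2 :: "'n ugraph \<Rightarrow> (real^'n^'n) set" where
  "STAB2 H = convex hull (outer ` stable_set_vectors H)"

text \<open>
  The following definitions are meant for graphs \<open>G\<close> with \<open>verts G = UNIV\<close>.
\<close>

definition TH2 :: "'n ugraph \<Rightarrow> ((real^'n) \<times> (real^'n^'n)) set" where
  "TH2 G = {(x, X). symmetric X \<and> diag X = x \<and>
     (\<forall>i j. {i, j} \<in> edges G \<longrightarrow> X $ i $ j = 0) \<and> psd (X - outer x)}"

definition CTH2 :: "'n ugraph \<Rightarrow> (real^'n^'n) set" where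
  "CTH2 G = {X. symmetric X \<and> trace X = 1 \<and>
     (\<forall>i j. {i, j} \<in> edges G \<longrightarrow> X $ i $ j = 0) \<and> psd X}"

text \<open>
  Maxima are taken with \<open>GREATEST\<close>, which denotes the largest element of the set of
  objective values. It is a maximum, not merely a supremum: both feasible sets are
  nonempty and compact (\<open>X = 0\<close> is feasible in the first problem, \<open>outer (axis i 1)\<close>
  in the second). The inner product of matrices is the entrywise one, and \<open>vec 1\<close> and
  \<open>vec (vec 1)\<close> are the all-ones vector and the all-ones matrix.
\<close>

definition zE :: "'n::finite set set \<Rightarrow> 'n ugraph \<Rightarrow> real" where
  "zE J G = (GREATEST z. \<exists>x X. z = vec 1 \<bullet> x \<and> (x, X) \<in> TH2 G \<and>
     (\<forall>I\<in>J. submatrix X I \<in> STAB2 (induced_subgraph G I)))"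

definition zC :: "'n::finite set set \<Rightarrow> 'n ugraph \<Rightarrow> real" where
  "zC J G = (GREATEST z. \<exists>X. z = vec (vec 1) \<bullet> X \<and> X \<in> CTH2 G \<and>
     (\<forall>I\<in>J. submatrix X I \<in> STAB2 (induced_subgraph G I)))"

end

theory Submission
  imports Defs
begin

text \<open>
  Divide an optimal solution \<open>X\<close> of the first problem by its trace
  \<open>z = zE J G\<close>. The quotient satisfies the trace constraint of the second problem and
  inherits positive semidefiniteness and the zeros on the edges. Evaluating the quadratic
  form of \<open>X - outer (diag X)\<close> at the all-ones vector shows that the entries of \<open>X\<close> sum to
  at least \<open>z\<^sup>2\<close>, so the objective value of the quotient is at least \<open>z\<close>
  (\<open>trace_squared_le_sum_entries\<close>).

  The exact subgraph constraints survive because \<open>z \<ge> 1\<close> and because the squared stable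
  set polytope is convex and contains the zero matrix, the square of the empty stable set:
  shrinking a point of it towards the origin does not leave it (\<open>scaleR_STAB2\<close>).
  The bound \<open>z \<ge> 1\<close> follows from optimality, since a single vertex is a stable set
  (\<open>single_vertex_feasible\<close>).

  As the optimal values are given by \<open>GREATEST\<close>, both maxima must be shown to be attained.
  This is compactness: the entries of a positive semidefinite matrix are bounded by its
  diagonal, and in both problems the diagonal entries are at most \<open>1\<close>.
\<close>

section \<open>Maxima over compact sets\<close>

lemma Greatest_on_compact:
  fixes f :: "'a::topological_space \<Rightarrow> real"
  assumes "compact S" "S \<noteq> {}" "continuous_on S f"
  defines "m \<equiv> (GREATEST z. \<exists>x. z = f x \<and> x \<in> S)"
  shows "\<exists>x\<in>S. f x = m" and "\<And>y. y \<in> S \<Longrightarrow> f y \<le> m"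
proof -
  obtain x where x: "x \<in> S" "\<And>y. y \<in> S \<Longrightarrow> f y \<le> f x"
    using continuous_attains_sup[OF assms(1-3)] by blast
  have "m = f x"
    unfolding m_def by (rule Greatest_equality) (use x in auto)
  then show "\<exists>x\<in>S. f x = m" and "\<And>y. y \<in> S \<Longrightarrow> f y \<le> m"
    using x by auto
qed

section \<open>Positive semidefinite matrices\<close>

lemma symmetric_iff: "symmetric X \<longleftrightarrow> (\<forall>i j. X $ i $ j = X $ j $ i)"
  by (auto simp: symmetric_def transpose_def vec_eq_iff)

lemma symmetric_outer: "symmetric (outer x)"
  by (simp add: symmetric_iff outer_def mult.commute)

lemma inner_outer_mult: "v \<bullet> (outer x *v v) = (v \<bullet> x)\<^sup>2"
  by (simp add: outer_def inner_vec_def matrix_vector_mult_def power2_eq_square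
      sum_product sum_distrib_left mult_ac)

lemma psd_outer: "psd (outer x)"
  by (simp add: psd_def symmetric_outer inner_outer_mult)

lemma psd_add: "psd X \<Longrightarrow> psd Y \<Longrightarrow> psd (X + Y)"
  by (simp add: psd_def symmetric_iff matrix_vector_mult_add_rdistrib inner_add_right)

lemma psd_scaleR: "0 \<le> c \<Longrightarrow> psd X \<Longrightarrow> psd (c *\<^sub>R X)"
  by (simp add: psd_def symmetric_iff scaleR_matrix_vector_assoc[symmetric])

lemma psd_diag_nonneg:
  assumes "psd X"
  shows "0 \<le> X $ i $ i"
proof -
  have "0 \<le> axis i 1 \<bullet> (X *v axis i 1)"
    using assms by (auto simp: psd_def)
  then show ?thesis
    by (simp add: matrix_vector_mult_basis column_def inner_axis')
qed

text \<open>
  The quadratic form is nonnegative at the sum and at the difference of two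
  coordinate vectors.
\<close>

lemma psd_entry_bound:
  assumes "psd X"
  shows "\<bar>X $ i $ j\<bar> \<le> (X $ i $ i + X $ j $ j) / 2"
proof -
  have "0 \<le> (axis i 1 + axis j 1) \<bullet> (X *v (axis i 1 + axis j 1))"
    and "0 \<le> (axis i 1 - axis j 1) \<bullet> (X *v (axis i 1 - axis j 1))"
    using assms by (auto simp: psd_def)
  moreover have "X $ j $ i = X $ i $ j"
    using assms by (simp add: psd_def symmetric_iff)
  ultimately show ?thesis
    by (simp add: matrix_vector_right_distrib matrix_vector_mult_diff_distrib
        matrix_vector_mult_basis column_def inner_axis' inner_add_left inner_diff_left)
qed

lemma closed_symmetric: "closed {X :: real^'n^'n. symmetric X}"
  unfolding symmetric_iff
  by (intro closed_Collect_all closed_Collect_eq continuous_intros)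

lemma closed_psd: "closed {X :: real^'n::finite^'n. psd X}"
  unfolding psd_def matrix_vector_mult_def inner_vec_def
  by (intro closed_Collect_conj closed_symmetric closed_Collect_all closed_Collect_le)
    (simp, intro continuous_intros)+

lemma bounded_psd_diag_le_1: "bounded {X :: real^'n::finite^'n. psd X \<and> (\<forall>i. X $ i $ i \<le> 1)}"
proof (rule boundedI)
  fix X :: "real^'n^'n"
  assume "X \<in> {X. psd X \<and> (\<forall>i. X $ i $ i \<le> 1)}"
  then have X: "psd X" "\<And>i. X $ i $ i \<le> 1"
    by auto
  have entry: "\<bar>X $ i $ j\<bar> \<le> 1" for i j
    using psd_entry_bound[OF X(1), of i j] add_mono[OF X(2)[of i] X(2)[of j]] by simp
  have "norm X \<le> (\<Sum>i\<in>UNIV. norm (X $ i))"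
    unfolding norm_vec_def[of X] by (rule L2_set_le_sum) simp
  also have "\<dots> \<le> (\<Sum>i\<in>(UNIV::'n set). \<Sum>j\<in>(UNIV::'n set). 1)"
    by (intro sum_mono order_trans[OF norm_le_l1_cart] entry)
  finally show "norm X \<le> (\<Sum>i\<in>(UNIV::'n set). \<Sum>j\<in>(UNIV::'n set). 1)" .
qed

lemma trace_eq_inner_diag: "trace X = vec 1 \<bullet> diag X"
  by (simp add: trace_def diag_def inner_vec_def)

lemma sum_entries_eq_inner_mult: "vec (vec 1) \<bullet> X = vec 1 \<bullet> (X *v vec 1)"
  for X :: "real^'n^'m"
  by (simp add: inner_vec_def matrix_vector_mult_def)

text \<open>The quadratic form of \<open>X - outer (diag X)\<close> is nonnegative at the all-ones vector.\<close>

lemma trace_squared_le_sum_entries: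
  assumes "psd (X - outer (diag X))"
  shows "(trace X)\<^sup>2 \<le> vec (vec 1) \<bullet> X"
proof -
  have "0 \<le> vec 1 \<bullet> ((X - outer (diag X)) *v vec 1)"
    using assms by (simp add: psd_def)
  then show ?thesis
    unfolding sum_entries_eq_inner_mult trace_eq_inner_diag
    by (simp add: matrix_vector_mult_diff_rdistrib inner_diff_right inner_outer_mult)
qed

lemma psd_of_psd_minus_outer: "psd (X - outer x) \<Longrightarrow> psd X"
  using psd_add[OF _ psd_outer, of "X - outer x" x] by simp

section \<open>The squared stable set polytope\<close>

lemma finite_stable_set_vectors: "finite (stable_set_vectors H)"
proof (rule finite_subset)
  show "stable_set_vectors H \<subseteq> range (\<lambda>A. \<chi> i. if i \<in> A then 1 else 0)"
  proof
    fix s assume s: "s \<in> stable_set_vectors H"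
    have "s = (\<chi> i. if i \<in> {i. s $ i = 1} then 1 else 0)"
      using s by (auto simp: vec_eq_iff stable_set_vectors_def)
    then show "s \<in> range (\<lambda>A. \<chi> i. if i \<in> A then 1 else 0)"
      by blast
  qed
qed simp

lemma compact_STAB2: "compact (STAB2 H)"
  by (simp add: STAB2_def finite_stable_set_vectors finite_imp_compact_convex_hull)

lemma outer_in_STAB2: "s \<in> stable_set_vectors H \<Longrightarrow> outer s \<in> STAB2 H"
  by (auto simp: STAB2_def intro: hull_inc)

lemma zero_in_STAB2: "0 \<in> STAB2 H"
proof -
  have "outer 0 \<in> STAB2 H"
    by (rule outer_in_STAB2) (simp add: stable_set_vectors_def)
  moreover have "outer (0 :: real^'a) = 0"
    by (simp add: outer_def vec_eq_iff)
  ultimately show ?thesis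
    by simp
qed

lemma scaleR_STAB2:
  assumes "X \<in> STAB2 H" "0 \<le> c" "c \<le> 1"
  shows "c *\<^sub>R X \<in> STAB2 H"
proof -
  have "convex (STAB2 H)"
    by (simp add: STAB2_def)
  from convexD_alt[OF this zero_in_STAB2 assms] show ?thesis
    by simp
qed

lemma submatrix_scaleR: "submatrix (c *\<^sub>R X) I = c *\<^sub>R submatrix X I"
  by (simp add: submatrix_def vec_eq_iff)

definition exact_subgraph_matrices :: "'n set set \<Rightarrow> 'n ugraph \<Rightarrow> (real^'n^'n) set" where
  "exact_subgraph_matrices J G = {X. \<forall>I\<in>J. submatrix X I \<in> STAB2 (induced_subgraph G I)}"

lemma closed_exact_subgraph_matrices: "closed (exact_subgraph_matrices J (G :: 'n::finite ugraph))"
proof -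
  have "continuous_on UNIV (\<lambda>X :: real^'n^'n. submatrix X I)" for I
    unfolding submatrix_def
  proof (intro continuous_on_vec_lambda)
    fix i j
    show "continuous_on UNIV (\<lambda>X :: real^'n^'n. if i \<in> I \<and> j \<in> I then X $ i $ j else 0)"
      by (cases "i \<in> I \<and> j \<in> I") (auto intro!: continuous_intros)
  qed
  then have "closed ((\<lambda>X. submatrix X I) -` STAB2 (induced_subgraph G I))" for I
    by (intro closed_vimage compact_imp_closed compact_STAB2)
  then have "closed (\<Inter>I\<in>J. (\<lambda>X. submatrix X I) -` STAB2 (induced_subgraph G I))"
    by blast
  also have "(\<Inter>I\<in>J. (\<lambda>X. submatrix X I) -` STAB2 (induced_subgraph G I)) = exact_subgraph_matrices J G"
    by (auto simp: exact_subgraph_matrices_def)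
  finally show ?thesis .
qed

section \<open>Compactness of the feasible sets\<close>

text \<open>The vector in a pair of \<open>TH2 G\<close> is the diagonal of the matrix, so it can be dropped.\<close>

definition TH2_matrices :: "'n ugraph \<Rightarrow> (real^'n^'n) set" where
  "TH2_matrices G = {X. (diag X, X) \<in> TH2 G}"

lemma closed_TH2_matrices: "closed (TH2_matrices (G :: 'n::finite ugraph))"
proof -
  have "continuous_on UNIV (\<lambda>X :: real^'n^'n. X - outer (diag X))"
    unfolding outer_def diag_def by (simp, intro continuous_intros continuous_on_vec_lambda)
  then have "closed ((\<lambda>X :: real^'n^'n. X - outer (diag X)) -` {X. psd X})"
    by (intro closed_vimage closed_psd)
  then have "closed {X :: real^'n^'n. psd (X - outer (diag X))}"
    by (simp add: vimage_def)
  then have "closed {X. symmetric X \<and> (\<forall>i j. {i, j} \<in> edges G \<longrightarrow> X $ i $ j = 0)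
      \<and> psd (X - outer (diag X))}"
    by (intro closed_Collect_conj closed_symmetric closed_Collect_all closed_Collect_imp
        closed_Collect_eq continuous_intros) auto
  then show ?thesis
    by (simp add: TH2_matrices_def TH2_def)
qed

lemma closed_CTH2: "closed (CTH2 (G :: 'n::finite ugraph))"
  unfolding CTH2_def trace_def
  by (intro closed_Collect_conj closed_symmetric closed_psd closed_Collect_all
      closed_Collect_imp closed_Collect_eq continuous_intros) auto

text \<open>A diagonal entry \<open>d\<close> of \<open>X\<close> gives the diagonal entry \<open>d - d\<^sup>2\<close> of \<open>X - outer (diag X)\<close>.\<close>

lemma TH2_matrices_diag_le_1:
  assumes "X \<in> TH2_matrices G"
  shows "X $ i $ i \<le> 1"
proof -
  have "0 \<le> (X - outer (diag X)) $ i $ i"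
    using assms by (intro psd_diag_nonneg) (simp add: TH2_matrices_def TH2_def)
  then have "(X $ i $ i)\<^sup>2 \<le> X $ i $ i"
    by (simp add: outer_def diag_def power2_eq_square)
  moreover have "X $ i $ i < (X $ i $ i)\<^sup>2" if "1 < X $ i $ i"
    using that by (simp add: power2_eq_square)
  ultimately show ?thesis
    by force
qed

lemma CTH2_diag_le_1:
  assumes "X \<in> CTH2 G"
  shows "X $ i $ i \<le> 1"
proof -
  have "X $ i $ i \<le> trace X"
    unfolding trace_def
    using assms by (intro member_le_sum) (auto simp: CTH2_def psd_diag_nonneg)
  then show ?thesis
    using assms by (simp add: CTH2_def)
qed

lemma compact_closed_psd_diag_le_1:
  fixes S :: "(real^'n::finite^'n) set"
  assumes "closed S" "\<And>X. X \<in> S \<Longrightarrow> psd X" "\<And>X i. X \<in> S \<Longrightarrow> X $ i $ i \<le> 1"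
  shows "compact S"
proof -
  have "bounded S"
    by (rule bounded_subset[OF bounded_psd_diag_le_1]) (use assms(2,3) in auto)
  with assms(1) show ?thesis
    by (simp add: compact_eq_bounded_closed)
qed

lemma compact_TH2_matrices: "compact (TH2_matrices (G :: 'n::finite ugraph))"
proof (rule compact_closed_psd_diag_le_1[OF closed_TH2_matrices])
  show "psd X" if "X \<in> TH2_matrices G" for X
    by (rule psd_of_psd_minus_outer[of _ "diag X"])
      (use that in \<open>simp add: TH2_matrices_def TH2_def\<close>)
qed (rule TH2_matrices_diag_le_1)

lemma compact_CTH2: "compact (CTH2 (G :: 'n::finite ugraph))"
  by (rule compact_closed_psd_diag_le_1[OF closed_CTH2 _ CTH2_diag_le_1]) (auto simp: CTH2_def)

section \<open>Comparison of the two maxima\<close>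

text \<open>This gives both the nonemptiness of the feasible set and \<open>zE J G \<ge> 1\<close>.\<close>

lemma single_vertex_feasible:
  fixes G :: "'n::finite ugraph"
  assumes "simple_graph G"
  shows "outer (axis i 1) \<in> TH2_matrices G \<inter> exact_subgraph_matrices J G"
proof -
  have no_loop: "{j} \<notin> edges G" for j
    using assms by (auto simp: simple_graph_def)
  have diag: "diag (outer (axis i 1)) = (axis i 1 :: real^'n)"
    by (simp add: diag_def outer_def axis_def vec_eq_iff)
  have "psd (0 :: real^'n^'n)"
    by (simp add: psd_def symmetric_iff)
  moreover have "outer (axis i 1) $ j $ k = (0::real)" if "{j, k} \<in> edges G" for j k
    using that no_loop[of i] by (auto simp: outer_def axis_def)
  ultimately have "outer (axis i 1) \<in> TH2_matrices G"
    by (simp add: TH2_matrices_def TH2_def diag symmetric_outer)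
  moreover have "submatrix (outer (axis i 1)) I \<in> STAB2 (induced_subgraph G I)" for I
  proof (cases "i \<in> I")
    case True
    then have "submatrix (outer (axis i 1)) I = outer (axis i (1::real))"
      by (auto simp: submatrix_def outer_def axis_def vec_eq_iff)
    moreover have "axis i 1 \<in> stable_set_vectors (induced_subgraph G I)"
      using True no_loop[of i]
      by (auto simp: stable_set_vectors_def induced_subgraph_def axis_def)
    ultimately show ?thesis
      by (simp add: outer_in_STAB2)
  next
    case False
    then have "submatrix (outer (axis i 1)) I = (0 :: real^'n^'n)"
      by (auto simp: submatrix_def outer_def axis_def vec_eq_iff)
    then show ?thesis
      by (simp add: zero_in_STAB2)
  qed
  ultimately show ?thesis
    by (simp add: exact_subgraph_matrices_def)
qed

lemma zE_eq:
  "zE J G = (GREATEST z. \<exists>X. z = trace X \<and> X \<in> TH2_matrices G \<inter> exact_subgraph_matrices J G)"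
proof -
  have "(\<exists>x X. z = vec 1 \<bullet> x \<and> (x, X) \<in> TH2 G \<and>
        (\<forall>I\<in>J. submatrix X I \<in> STAB2 (induced_subgraph G I)))
      \<longleftrightarrow> (\<exists>X. z = trace X \<and> X \<in> TH2_matrices G \<inter> exact_subgraph_matrices J G)" for z
    by (auto simp: TH2_matrices_def TH2_def exact_subgraph_matrices_def trace_eq_inner_diag)
  then show ?thesis
    by (simp add: zE_def)
qed

lemma zC_eq:
  "zC J G = (GREATEST z. \<exists>X. z = vec (vec 1) \<bullet> X \<and> X \<in> CTH2 G \<inter> exact_subgraph_matrices J G)"
  by (simp add: zC_def exact_subgraph_matrices_def)

lemma trace_scaleR: "trace (c *\<^sub>R X) = c * trace X" for X :: "real^'n^'n"
  by (simp add: trace_def sum_distrib_left)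

text \<open>
  Only matrices of trace at least \<open>1\<close> are treated: then the division by the trace is a
  contraction towards the zero matrix.
\<close>

lemma normalized_feasible:
  assumes "X \<in> TH2_matrices G \<inter> exact_subgraph_matrices J G" "1 \<le> trace X"
  shows "(1 / trace X) *\<^sub>R X \<in> CTH2 G \<inter> exact_subgraph_matrices J G"
proof -
  have X: "psd X" "\<And>i j. {i, j} \<in> edges G \<Longrightarrow> X $ i $ j = 0"
    using assms(1) by (auto simp: TH2_matrices_def TH2_def dest: psd_of_psd_minus_outer)
  have "psd ((1 / trace X) *\<^sub>R X)"
    using X(1) assms(2) by (intro psd_scaleR) auto
  then have "(1 / trace X) *\<^sub>R X \<in> CTH2 G"
    using X(2) assms(2) by (simp add: CTH2_def trace_scaleR psd_def)
  moreover have "(1 / trace X) *\<^sub>R X \<in> exact_subgraph_matrices J G"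
    using assms by (auto simp: exact_subgraph_matrices_def submatrix_scaleR intro!: scaleR_STAB2)
  ultimately show ?thesis
    by blast
qed

theorem theorem1:
  fixes G :: "'n::finite ugraph" and J :: "'n set set"
  assumes "simple_graph G" and "verts G = UNIV"
    and "J \<subseteq> Pow (verts G)"
  shows "zE J G \<le> zC J G"
proof -
  let ?E = "TH2_matrices G \<inter> exact_subgraph_matrices J G" and ?C = "CTH2 G \<inter> exact_subgraph_matrices J G"
  \<comment> \<open>Any vertex can be used in \<open>?e\<close>; the index type has one because types are nonempty.\<close>
  let ?z = "zE J G" and ?e = "axis undefined 1 :: real^'n"
  have vertex: "outer ?e \<in> ?E"
    using assms(1) by (rule single_vertex_feasible)
  have trace_vertex: "trace (outer ?e) = 1"
    by (simp add: trace_def outer_def axis_def if_distrib cong: if_cong)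
  have E: "compact ?E" "?E \<noteq> {}"
    using vertex by (auto intro!: compact_Int_closed compact_TH2_matrices closed_exact_subgraph_matrices)
  have "continuous_on ?E trace"
    unfolding trace_def by (intro continuous_intros)
  note max_E = Greatest_on_compact[OF E this, folded zE_eq]
  obtain X where X: "X \<in> ?E" "trace X = ?z"
    using max_E(1) by blast
  have z: "1 \<le> ?z"
    using max_E(2)[OF vertex] by (simp add: trace_vertex)
  have feasible: "(1 / ?z) *\<^sub>R X \<in> ?C"
    using normalized_feasible[OF X(1)] X(2) z by simp

  have C: "compact ?C" "?C \<noteq> {}"
    using feasible by (auto intro!: compact_Int_closed compact_CTH2 closed_exact_subgraph_matrices)
  have "continuous_on ?C (\<lambda>X. vec (vec 1) \<bullet> X)"
    by (intro continuous_intros)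
  note max_C = Greatest_on_compact(2)[OF C this, folded zC_eq]

  have "?z\<^sup>2 \<le> vec (vec 1) \<bullet> X"
    using trace_squared_le_sum_entries[of X] X by (simp add: TH2_matrices_def TH2_def)
  then have "?z \<le> vec (vec 1) \<bullet> ((1 / ?z) *\<^sub>R X)"
    using z by (simp add: field_simps power2_eq_square)
  also have "\<dots> \<le> zC J G"
    using feasible by (rule max_C)
  finally show ?thesis .
qed

end
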